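(* Let $r\ge 2$, let $d_0,\dots,d_{r-1}>0$ with $\sum_{s=0}^{r-1}d_s=1$ be the ideal linear weights, let $\epsilon>0$, and let $\beta_0,\dots,\beta_{r-1}\ge 0$ be the smoothness indicators of the $r$ substencils $S_0,\dots,S_{r-1}$ of a $(2r-1)$-point global stencil centered around an arbitrary grid point $x_j$. Let $$\alpha_s^{\mathrm{JS}}=\frac{d_s}{(\epsilon+\beta_s)^2},\qquad \omega_s^{\mathrm{JS}}=\frac{\alpha_s^{\mathrm{JS}}}{\sum_{l=0}^{r-1}\alpha_l^{\mathrm{JS}}},\qquad s=0,\dots,r-1 .$$ Let $g^{\mathrm{X}}_s:[0,1]\to\mathbb{R}$, $s=0,\dots,r-1$, be the mapping functions of a mapped WENO-X scheme, each monotonically increasing over $[0,1]$, such that the set $\{g^{\mathrm{X}}_s : s=0,\dots,r-1\}$ is non-order-preserving (non-OP). Let $\{(g^{\mathrm{LOP-X}})_s(\omega_s^{\mathrm{JS}}) : s=0,\dots,r-1\}$ be the output of the LOP construction (defined in the context) applied to these data. Then the set of mapping functions $\{(g^{\mathrm{LOP-X}})_s(\omega_s^{\mathrm{JS}}) : s=0,\dots,r-1\}$ is locally order-preserving (LOP); that is, for all $m,n\in\{0,\dots,r-1\}$: if $\omega_m^{\mathrm{JS}}>\omega_n^{\mathrm{JS}}$ then $(g^{\mathrm{LOP-X}})_m(\omega_m^{\mathrm{JS}})\ge (g^{\mathrm{LOP-X}})_n(\omega_n^{\mathrm{JS}})$, and if $\omega_m^{\mathrm{JS}}=\omega_n^{\mathrm{JS}}$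 then $(g^{\mathrm{LOP-X}})_m(\omega_m^{\mathrm{JS}})= (g^{\mathrm{LOP-X}})_n(\omega_n^{\mathrm{JS}})$.
   Context: Order-preserving (OP) mappings: a set of monotonically increasing functions $\{g_s : s=0,\dots,r-1\}$ on $[0,1]$ is OP if for all $m,n\in\{0,\dots,r-1\}$ and all $\omega_m,\omega_n\in(0,1)$, $\omega_m>\omega_n$ implies $g_m(\omega_m)\ge g_n(\omega_n)$, and $\omega_m=\omega_n$ implies $g_m(\omega_m)=g_n(\omega_n)$. Otherwise it is non-OP. Locally order-preserving (LOP) mappings: given, for each grid point $x_j$, the nonlinear weights $\omega_0,\dots,\omega_{r-1}$ associated with the $r$-point substencils $S_0,\dots,S_{r-1}$ of the $(2r-1)$-point global stencil centered around $x_j$, a set of mapping functions $\{g_s: s=0,\dots,r-1\}$ is LOP if, for every $x_j$ and all $m,n\in\{0,\dots,r-1\}$, $\omega_m>\omega_n$ implies $g_m(\omega_m)\ge g_n(\omega_n)$, and $\omega_m=\omega_n$ implies $g_m(\omega_m)=g_n(\omega_n)$. Here the nonlinear weights are $\omega_s=\omega_s^{\mathrm{JS}}$. postINDEX function: for $a,b\in\{0,\dots,r-1\}$, $$\mathbf{postINDEX}(a,b,\mathrm{X})=\big(\omega_a^{\mathrm{JS}}-\omega_b^{\mathrm{JS}}\big)\big(g_a^{\mathrm{X}}(\omega_a^{\mathrm{JS}})-g_b^{\mathrm{X}}(\omega_b^{\mathrm{JS}})\big).$$ One says that $\mathbf{postINDEX}(a,b,\mathrm{X})\in\mathbb{S}^{\mathrm{X}}$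 if either $\mathbf{postINDEX}(a,b,\mathrm{X})>0$, or $\omega_a^{\mathrm{JS}}-\omega_b^{\mathrm{JS}}=g_a^{\mathrm{X}}(\omega_a^{\mathrm{JS}})-g_b^{\mathrm{X}}(\omega_b^{\mathrm{JS}})=0$. LOP construction: run through the pairs $(s_1,s_2)$ with $0\le s_1<s_2\le r-1$. Set $\lambda=1$ if $\mathbf{postINDEX}(s_1,s_2,\mathrm{X})\in\mathbb{S}^{\mathrm{X}}$ for all such pairs; set $\lambda=0$ (and stop the search) as soon as some pair has $\mathbf{postINDEX}(s_1,s_2,\mathrm{X})\notin\mathbb{S}^{\mathrm{X}}$. Then for every $s=0,\dots,r-1$ output $$(g^{\mathrm{LOP-X}})_s(\omega_s^{\mathrm{JS}})=\begin{cases} g_s^{\mathrm{X}}(\omega_s^{\mathrm{JS}}), & \lambda=1,\\ \alpha_s^{\mathrm{JS}}, & \lambda=0.\end{cases}$$ *)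

theory Defs
  imports Complex_Main
begin

text \<open>
  A family of mapping functions is indexed by the substencils \<open>s < r\<close>. Its members are functions
  on \<open>[0,1]\<close>, represented as total functions of which only the values on \<open>[0,1]\<close> are relevant.
\<close>

definition order_preserving :: "nat \<Rightarrow> (nat \<Rightarrow> real \<Rightarrow> real) \<Rightarrow> bool" where
  "order_preserving r g \<longleftrightarrow>
     (\<forall>m<r. \<forall>n<r. \<forall>u\<in>{0<..<1}. \<forall>v\<in>{0<..<1}.
        (u > v \<longrightarrow> g m u \<ge> g n v) \<and> (u = v \<longrightarrow> g m u = g n v))"

text \<open>
  The type \<open>'p\<close> is the type of grid points, and \<open>\<omega> x s\<close> is the weight of the \<open>s\<close>-th substencil of
  the global stencil centred around \<open>x\<close>. The mapping functions may vary with the grid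
  point, because those produced by the LOP construction do.
\<close>

definition locally_order_preserving ::
    "nat \<Rightarrow> ('p \<Rightarrow> nat \<Rightarrow> real) \<Rightarrow> ('p \<Rightarrow> nat \<Rightarrow> real \<Rightarrow> real) \<Rightarrow> bool" where
  "locally_order_preserving r \<omega> g \<longleftrightarrow>
     (\<forall>x. \<forall>m<r. \<forall>n<r.
        (\<omega> x m > \<omega> x n \<longrightarrow> g x m (\<omega> x m) \<ge> g x n (\<omega> x n)) \<and>
        (\<omega> x m = \<omega> x n \<longrightarrow> g x m (\<omega> x m) = g x n (\<omega> x n)))"

definition alpha_JS :: "(nat \<Rightarrow> real) \<Rightarrow> real \<Rightarrow> (nat \<Rightarrow> real) \<Rightarrow> nat \<Rightarrow> real" where
  "alpha_JS d \<epsilon> \<beta> s = d s / (\<epsilon> + \<beta> s)\<^sup>2"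

definition omega_JS :: "nat \<Rightarrow> (nat \<Rightarrow> real) \<Rightarrow> real \<Rightarrow> (nat \<Rightarrow> real) \<Rightarrow> nat \<Rightarrow> real" where
  "omega_JS r d \<epsilon> \<beta> s = alpha_JS d \<epsilon> \<beta> s / (\<Sum>l<r. alpha_JS d \<epsilon> \<beta> l)"

definition postINDEX :: "(nat \<Rightarrow> real) \<Rightarrow> (nat \<Rightarrow> real \<Rightarrow> real) \<Rightarrow> nat \<Rightarrow> nat \<Rightarrow> real" where
  "postINDEX \<omega> g a b = (\<omega> a - \<omega> b) * (g a (\<omega> a) - g b (\<omega> b))"

text \<open>
  Membership of \<open>postINDEX(a, b, X)\<close> in \<open>S\<^sup>X\<close> depends on the pair \<open>(a, b)\<close> and not only on
  the value of \<open>postINDEX\<close>, so it is a predicate on pairs.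
\<close>

definition postINDEX_in_S :: "(nat \<Rightarrow> real) \<Rightarrow> (nat \<Rightarrow> real \<Rightarrow> real) \<Rightarrow> nat \<Rightarrow> nat \<Rightarrow> bool" where
  "postINDEX_in_S \<omega> g a b \<longleftrightarrow>
     postINDEX \<omega> g a b > 0 \<or>
     (\<omega> a - \<omega> b = g a (\<omega> a) - g b (\<omega> b) \<and> g a (\<omega> a) - g b (\<omega> b) = 0)"

definition lop_lambda :: "nat \<Rightarrow> (nat \<Rightarrow> real) \<Rightarrow> (nat \<Rightarrow> real \<Rightarrow> real) \<Rightarrow> nat" where
  "lop_lambda r \<omega> g =
     (if \<forall>s1 s2. s1 < s2 \<and> s2 < r \<longrightarrow> postINDEX_in_S \<omega> g s1 s2 then 1 else 0)"

text \<open>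
  For \<open>\<lambda> = 0\<close> the mapping function is constant in its argument \<open>w\<close>. The construction only ever
  uses its value at \<open>w = omega_JS r d \<epsilon> \<beta> s\<close>.
\<close>

definition lop_map ::
    "nat \<Rightarrow> (nat \<Rightarrow> real) \<Rightarrow> real \<Rightarrow> (nat \<Rightarrow> real \<Rightarrow> real) \<Rightarrow> (nat \<Rightarrow> real) \<Rightarrow> nat \<Rightarrow> real \<Rightarrow> real" where
  "lop_map r d \<epsilon> g \<beta> s w =
     (if lop_lambda r (omega_JS r d \<epsilon> \<beta>) g = 1 then g s w else alpha_JS d \<epsilon> \<beta> s)"

end

theory Submission
  imports Defs
begin

text \<open>
  If \<open>\<lambda> = 1\<close>, membership in \<open>S\<^sup>X\<close> says that for each pair the weights and their images differ with
  the same sign or agree simultaneously. If \<open>\<lambda> = 0\<close>, the outputs are the unnormalised weights,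
  which are a fixed positive multiple of the normalised ones.
\<close>

text \<open>Swapping the indices negates both factors of \<open>postINDEX\<close>. The search visits
  only pairs with \<open>s1 < s2\<close>; this symmetry carries its result over to the remaining
  off-diagonal pairs.\<close>

lemma postINDEX_in_S_commute: "postINDEX_in_S \<omega> g a b \<longleftrightarrow> postINDEX_in_S \<omega> g b a"
  unfolding postINDEX_in_S_def postINDEX_def by (auto simp: algebra_simps)

text \<open>The degenerate alternative would force equal weights, so the product is positive and
  both factors share a sign.\<close>

lemma postINDEX_in_S_less:
  assumes "postINDEX_in_S \<omega> g a b" "\<omega> b < \<omega> a"
  shows "g b (\<omega> b) < g a (\<omega> a)"
  using assms unfolding postINDEX_in_S_def postINDEX_def by (auto simp: zero_less_mult_iff)

text \<open>Equal weights make \<open>postINDEX\<close> vanish, which leaves only the alternative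
  where both differences are zero.\<close>

lemma postINDEX_in_S_eq:
  assumes "postINDEX_in_S \<omega> g a b" "\<omega> a = \<omega> b"
  shows "g a (\<omega> a) = g b (\<omega> b)"
  using assms unfolding postINDEX_in_S_def postINDEX_def by auto

lemma lop_lambda_eq_1D:
  assumes "lop_lambda r \<omega> g = 1" "m < r" "n < r" "m \<noteq> n"
  shows "postINDEX_in_S \<omega> g m n"
  using assms postINDEX_in_S_commute[of \<omega> g m n]
  by (auto simp: lop_lambda_def neq_iff split: if_splits)

lemma alpha_JS_pos:
  assumes "d s > 0" "\<epsilon> > 0" "\<beta> s \<ge> 0"
  shows "alpha_JS d \<epsilon> \<beta> s > 0"
  using assms by (simp add: alpha_JS_def add_pos_nonneg)

lemma sum_alpha_JS_pos:
  assumes "r > 0" "\<And>s. s < r \<Longrightarrow> d s > 0" "\<epsilon> > 0" "\<And>s. s < r \<Longrightarrow> \<beta> s \<ge> 0"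
  shows "(\<Sum>l<r. alpha_JS d \<epsilon> \<beta> l) > 0"
  using assms by (intro sum_pos alpha_JS_pos) auto

theorem theorem1:
  fixes r :: nat and d :: "nat \<Rightarrow> real" and \<epsilon> :: real
    and \<beta> :: "'p \<Rightarrow> nat \<Rightarrow> real" and g :: "nat \<Rightarrow> real \<Rightarrow> real"
  assumes "r \<ge> 2"
    and "\<And>s. s < r \<Longrightarrow> d s > 0"
    and "(\<Sum>s<r. d s) = 1"
    and "\<epsilon> > 0"
    and "\<And>x s. s < r \<Longrightarrow> \<beta> x s \<ge> 0"
    and "\<And>s. s < r \<Longrightarrow> mono_on {0..1} (g s)"
    and "\<not> order_preserving r g"
  shows "locally_order_preserving r
           (\<lambda>x. omega_JS r d \<epsilon> (\<beta> x)) (\<lambda>x. lop_map r d \<epsilon> g (\<beta> x))"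
  unfolding locally_order_preserving_def
proof (intro allI impI)
  fix x m n
  assume m: "m < r" and n: "n < r"
  let ?\<omega> = "omega_JS r d \<epsilon> (\<beta> x)" and ?h = "lop_map r d \<epsilon> g (\<beta> x)"
  show "(?\<omega> m > ?\<omega> n \<longrightarrow> ?h m (?\<omega> m) \<ge> ?h n (?\<omega> n)) \<and>
        (?\<omega> m = ?\<omega> n \<longrightarrow> ?h m (?\<omega> m) = ?h n (?\<omega> n))"
  \<comment> \<open>The search does not test the diagonal. There the claim is trivial, so
    \<open>m = n\<close> is put together with \<lambda> = 0.\<close>
  proof (cases "lop_lambda r ?\<omega> g = 1 \<and> m \<noteq> n")
    case True
    then have "postINDEX_in_S ?\<omega> g m n"
      using lop_lambda_eq_1D m n by blast
    then show ?thesis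
      using True postINDEX_in_S_less[of ?\<omega> g m n] postINDEX_in_S_eq[of ?\<omega> g m n]
      by (simp add: lop_map_def less_imp_le)
  next
    case False
    \<comment> \<open>Positivity of the common denominator lets it be cancelled from both the strict
      inequality and the equality of weights.\<close>
    have "(\<Sum>l<r. alpha_JS d \<epsilon> (\<beta> x) l) > 0"
      using assms by (intro sum_alpha_JS_pos) auto
    then show ?thesis
      using False by (auto simp: lop_map_def omega_JS_def divide_less_cancel)
  qed
qed

end
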